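(* Let $r_1,r_2,\rho_1,\rho_2$ be real numbers with $g:=\rho_1+\rho_2-r_1-r_2\notin\{-1,-2,\dots\}$. For real $\varepsilon\ne0$ put $$q=-e^{\varepsilon},\quad a=ie^{\varepsilon(2\rho_1+3/2)},\quad b=-ie^{\varepsilon(2\rho_2+1/2)},\quad c=ie^{\varepsilon(-2r_2+1/2)},\quad d=ie^{\varepsilon(-2r_1+1/2)},\quad z=ie^{-2\varepsilon y},$$ with $y\in\mathbb{R}$. Let $Q_n(\,\cdot\,;a,b,c,d|q)$ be the Askey-Wilson polynomials, normalized to be monic in the variable $z+z^{-1}$. Then for every $n\ge0$ and $y\in\mathbb R$, $$\lim_{\varepsilon\to0}\frac{Q_n(z+z^{-1};a,b,c,d|q)}{(4i(1+q))^{n}}=W_n\!\left(y-\tfrac14;r_1,r_2,\rho_1,\rho_2\right),$$ where $W_n(x;r_1,r_2,\rho_1,\rho_2)$ are the monic complementary Bannai-Ito polynomials.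
   Context: The monic Askey-Wilson polynomials are given by $Q_{-1}=0$, $Q_0=1$, $Q_{n+1}(X)+(a+a^{-1}-A_n-C_n)Q_n(X)+A_{n-1}C_nQ_{n-1}(X)=XQ_n(X)$, where $C_0=0$ and $$A_n=\frac{(1-abq^n)(1-acq^n)(1-adq^n)(1-abcdq^{n-1})}{a(1-abcdq^{2n-1})(1-abcdq^{2n})},\qquad C_n=\frac{a(1-q^n)(1-bcq^{n-1})(1-bdq^{n-1})(1-cdq^{n-1})}{(1-abcdq^{2n-1})(1-abcdq^{2n-2})}\ (n\ge1);$$ equivalently $Q_n(z+z^{-1})$ is the constant multiple, monic in $z+z^{-1}$, of ${}_4\Phi_3\left({q^{-n},abcdq^{n-1},az,az^{-1}\atop ab,ac,ad}\Big|q;q\right)$. The monic complementary Bannai-Ito polynomials $W_n(x;r_1,r_2,\rho_1,\rho_2)$ satisfy $W_{-1}=0$, $W_0=1$ and $W_{n+1}(x)+(-1)^n\rho_2W_n(x)+v_nW_{n-1}(x)=xW_n(x)$, where $v_0=0$ and $$v_{2n}=-\frac{n(n+\rho_1-r_1+\frac12)(n+\rho_1-r_2+\frac12)(n-r_1-r_2)}{(2n+1+g)(2n+g)}\ (n\ge1),$$ $$v_{2n+1}=-\frac{(n+g+1)(n+\rho_1+\rho_2+1)(n+\rho_2-r_1+\frac12)(n+\rho_2-r_2+\frac12)}{(2n+1+g)(2n+g+2)}\ (n\ge0).$$ *)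

theory Defs
  imports Complex_Main "HOL-Computational_Algebra.Polynomial"
begin

text \<open>
  Integer exponents (\<open>powi\<close>) are used because \<open>n - 1\<close> and \<open>2n - 1\<close> are negative for \<open>n = 0\<close>.
\<close>

definition AW_A :: "complex \<Rightarrow> complex \<Rightarrow> complex \<Rightarrow> complex \<Rightarrow> complex \<Rightarrow> nat \<Rightarrow> complex" where
  "AW_A a b c d q n =
     (1 - a*b*q^n) * (1 - a*c*q^n) * (1 - a*d*q^n) * (1 - a*b*c*d * q powi (int n - 1))
     / (a * (1 - a*b*c*d * q powi (2 * int n - 1)) * (1 - a*b*c*d * q^(2*n)))"

definition AW_C :: "complex \<Rightarrow> complex \<Rightarrow> complex \<Rightarrow> complex \<Rightarrow> complex \<Rightarrow> nat \<Rightarrow> complex" where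
  "AW_C a b c d q n =
     (if n = 0 then 0
      else a * (1 - q^n) * (1 - b*c*q^(n-1)) * (1 - b*d*q^(n-1)) * (1 - c*d*q^(n-1))
           / ((1 - a*b*c*d * q^(2*n-1)) * (1 - a*b*c*d * q^(2*n-2))))"

text \<open>
  The second equation is the three-term recurrence at \<open>n = 0\<close>, where the \<open>Q\<^bsub>-1\<^esub>\<close> term vanishes.
  The polynomial variable is \<open>X = z + 1/z\<close>.
\<close>

fun askey_wilson_Q ::
  "complex \<Rightarrow> complex \<Rightarrow> complex \<Rightarrow> complex \<Rightarrow> complex \<Rightarrow> nat \<Rightarrow> complex poly" where
  "askey_wilson_Q a b c d q 0 = 1"
| "askey_wilson_Q a b c d q (Suc 0) =
     [:0, 1:] - [:a + inverse a - AW_A a b c d q 0 - AW_C a b c d q 0:]"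
| "askey_wilson_Q a b c d q (Suc (Suc n)) =
     ([:0, 1:] - [:a + inverse a - AW_A a b c d q (Suc n) - AW_C a b c d q (Suc n):])
       * askey_wilson_Q a b c d q (Suc n)
     - smult (AW_A a b c d q n * AW_C a b c d q (Suc n)) (askey_wilson_Q a b c d q n)"

text \<open>
  \<open>CBI_v m\<close> is \<open>v\<^sub>m\<close>; the two branches are the formulas for \<open>v\<^bsub>2n\<^esub>\<close> and \<open>v\<^bsub>2n+1\<^esub>\<close> with
  \<open>n = m div 2\<close>.
\<close>

definition CBI_v :: "real \<Rightarrow> real \<Rightarrow> real \<Rightarrow> real \<Rightarrow> nat \<Rightarrow> real" where
  "CBI_v r1 r2 \<rho>1 \<rho>2 m =
     (let g = \<rho>1 + \<rho>2 - r1 - r2; n = real (m div 2) in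
      if m = 0 then 0
      else if even m then
        - (n * (n + \<rho>1 - r1 + 1/2) * (n + \<rho>1 - r2 + 1/2) * (n - r1 - r2)
           / ((2*n + 1 + g) * (2*n + g)))
      else
        - ((n + g + 1) * (n + \<rho>1 + \<rho>2 + 1) * (n + \<rho>2 - r1 + 1/2) * (n + \<rho>2 - r2 + 1/2)
           / ((2*n + 1 + g) * (2*n + g + 2))))"

fun comp_bannai_ito_W :: "real \<Rightarrow> real \<Rightarrow> real \<Rightarrow> real \<Rightarrow> nat \<Rightarrow> real poly" where
  "comp_bannai_ito_W r1 r2 \<rho>1 \<rho>2 0 = 1"
| "comp_bannai_ito_W r1 r2 \<rho>1 \<rho>2 (Suc 0) = [:0, 1:] - [:\<rho>2:]"
| "comp_bannai_ito_W r1 r2 \<rho>1 \<rho>2 (Suc (Suc n)) =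
     ([:0, 1:] - [:(-1)^(Suc n) * \<rho>2:]) * comp_bannai_ito_W r1 r2 \<rho>1 \<rho>2 (Suc n)
     - smult (CBI_v r1 r2 \<rho>1 \<rho>2 (Suc n)) (comp_bannai_ito_W r1 r2 \<rho>1 \<rho>2 n)"

end

theory Submission
  imports Defs
begin

text \<open>
  The limit is taken in the three-term recurrence rather than in the polynomials. Write
  \<open>h = 4\<i>(1 + q)\<close> and \<open>X = z + 1/z\<close>. Dividing the recurrence for \<open>Q\<^bsub>n+1\<^esub>(X)\<close> by \<open>h\<^bsup>n+1\<^esup>\<close>
  gives a recurrence for \<open>Q\<^sub>n(X) / h\<^sup>n\<close> whose coefficients are built from \<open>X/h\<close>,
  \<open>(a + 1/a)/h\<close>, \<open>A\<^sub>n/h\<close> and \<open>C\<^sub>n/h\<close>, so by induction on the degree it is enough that these four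
  quantities have limits and that the limiting recurrence is the one of the complementary
  Bannai-Ito polynomials.

  Every factor of \<open>A\<^sub>n\<close> and \<open>C\<^sub>n\<close> has the form \<open>1 - e\<^bsup>k\<epsilon>\<^esup>\<close> or \<open>1 + e\<^bsup>k\<epsilon>\<^esup>\<close> for a real \<open>k\<close>, since
  all products of parameters that occur are real. Factors of the second kind tend to
  \<open>2\<close>. Those of the first kind vanish to first order, and \<open>(1 - e\<^bsup>k\<epsilon>\<^esup>) / (1 - e\<^sup>\<epsilon>)\<close> tends to \<open>k\<close>,
  where \<open>1 - e\<^sup>\<epsilon> = 1 + q\<close> (\<open>one_minus_rexp_quotient_tendsto\<close>). Each coefficient has two factors of
  each kind in the numerator and one of each kind in the denominator, hence is of the exact
  order of \<open>1 + q\<close> or smaller (\<open>rexp_quotient_tendsto\<close>). Because \<open>q\<close> tends to \<open>-1\<close>, the parity of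
  \<open>n\<close> decides which factors vanish. This is the source of the alternating sign and
  of the two branches of \<open>v\<^sub>n\<close>.

  The first-order denominator factor has slope \<open>2(g + n + 1)\<close>, which is nonzero exactly by the
  assumption on \<open>g\<close>. What remains is to identify the limits: it is a rational identity that the
  diagonal limits collapse to \<open>(-1)\<^sup>n \<rho>\<^sub>2 + 1/4\<close>, which explains the shift of \<open>y\<close> by \<open>1/4\<close>, and
  that the products of consecutive limits of \<open>A\<close> and \<open>C\<close> are the \<open>v\<^sub>n\<close>.
\<close>

section \<open>Real exponentials near zero\<close>

definition rexp :: "real \<Rightarrow> real \<Rightarrow> complex" where
  "rexp k \<epsilon> = complex_of_real (exp (\<epsilon> * k))"

lemma rexp_mult: "rexp k \<epsilon> * rexp l \<epsilon> = rexp (k + l) \<epsilon>"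
  by (simp add: rexp_def distrib_left exp_add)

lemma inverse_rexp: "inverse (rexp k \<epsilon>) = rexp (- k) \<epsilon>"
  by (simp add: rexp_def exp_minus)

lemma rexp_power: "rexp 1 \<epsilon> ^ n = rexp (real n) \<epsilon>"
  by (simp add: rexp_def mult.commute flip: of_real_power exp_of_nat_mult)

lemma rexp_powi: "rexp 1 \<epsilon> powi m = rexp (of_int m) \<epsilon>"
  by (simp add: rexp_def mult.commute exp_power_int flip: of_real_power_int)

lemma rexp_tendsto: "(rexp k \<longlongrightarrow> 1) (at 0)"
proof -
  have "((\<lambda>\<epsilon>. complex_of_real (exp (\<epsilon> * k))) \<longlongrightarrow> complex_of_real (exp (0 * k))) (at 0)"
    by (intro tendsto_intros)
  then show ?thesis
    by (simp add: rexp_def[abs_def])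
qed

lemma eventually_one_minus_rexp_nonzero: "\<forall>\<^sub>F \<epsilon> in at 0. 1 - rexp 1 \<epsilon> \<noteq> 0"
proof -
  have "1 - rexp 1 \<epsilon> \<noteq> 0" if "\<epsilon> \<noteq> 0" for \<epsilon>
    using that by (simp add: rexp_def)
  then show ?thesis
    by (simp add: eventually_at_filter)
qed

lemma one_minus_rexp_quotient_tendsto:
  "((\<lambda>\<epsilon>. (1 - rexp k \<epsilon>) / (1 - rexp 1 \<epsilon>)) \<longlongrightarrow> complex_of_real k) (at 0)"
proof -
  have slope: "((\<lambda>\<epsilon>. (exp (\<epsilon> * l) - 1) / \<epsilon>) \<longlongrightarrow> l) (at 0)" for l :: real
  proof -
    have "((\<lambda>\<epsilon>. exp (\<epsilon> * l)) has_field_derivative l) (at 0)"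
      by (auto intro!: derivative_eq_intros)
    then show ?thesis
      by (simp add: has_field_derivative_iff)
  qed
  have "((\<lambda>\<epsilon>. ((exp (\<epsilon> * k) - 1) / \<epsilon>) / ((exp (\<epsilon> * 1) - 1) / \<epsilon>)) \<longlongrightarrow> k / 1) (at 0)"
    by (intro tendsto_divide slope) simp
  moreover have "\<forall>\<^sub>F \<epsilon> in at 0. ((exp (\<epsilon> * k) - 1) / \<epsilon>) / ((exp (\<epsilon> * 1) - 1) / \<epsilon>)
      = (1 - exp (\<epsilon> * k)) / (1 - exp \<epsilon>)"
  proof -
    have "((exp (\<epsilon> * k) - 1) / \<epsilon>) / ((exp (\<epsilon> * 1) - 1) / \<epsilon>) = (1 - exp (\<epsilon> * k)) / (1 - exp \<epsilon>)"
      if "\<epsilon> \<noteq> 0" for \<epsilon>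
      using that minus_divide_divide[of "exp (\<epsilon> * k) - 1" "exp \<epsilon> - 1"] by simp
    then show ?thesis
      by (simp add: eventually_at_filter)
  qed
  ultimately have "((\<lambda>\<epsilon>. (1 - exp (\<epsilon> * k)) / (1 - exp \<epsilon>)) \<longlongrightarrow> k / 1) (at 0)"
    by (rule Lim_transform_eventually)
  from tendsto_of_real[OF this, where ?'a = complex] show ?thesis
    by (simp add: rexp_def)
qed

text \<open>
  This is the common shape of \<open>A\<^sub>n\<close> and \<open>C\<^sub>n\<close>. Two zeros against one pole leave a simple zero,
  which the division by \<open>1 - e\<^sup>\<epsilon>\<close> removes; the exponents of the nonvanishing factors do not
  survive in the limit, and those factors contribute \<open>2 \<sqdot> 2 / 2\<close>.
\<close>

lemma rexp_quotient_tendsto: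
  assumes "l \<noteq> 0"
  shows "((\<lambda>\<epsilon>. (1 - rexp k1 \<epsilon>) * (1 - rexp k2 \<epsilon>) * (1 + rexp m1 \<epsilon>) * (1 + rexp m2 \<epsilon>)
             / ((1 - rexp l \<epsilon>) * (1 + rexp p \<epsilon>)) / (1 - rexp 1 \<epsilon>))
          \<longlongrightarrow> complex_of_real (2 * k1 * k2 / l)) (at 0)"
proof -
  let ?h = "\<lambda>k \<epsilon>. (1 - rexp k \<epsilon>) / (1 - rexp 1 \<epsilon>)"
  have "((\<lambda>\<epsilon>. ?h k1 \<epsilon> * ?h k2 \<epsilon> * (1 + rexp m1 \<epsilon>) * (1 + rexp m2 \<epsilon>) / (?h l \<epsilon> * (1 + rexp p \<epsilon>)))
      \<longlongrightarrow> complex_of_real k1 * complex_of_real k2 * (1 + 1) * (1 + 1)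
          / (complex_of_real l * (1 + 1))) (at 0)"
    using assms by (intro tendsto_intros rexp_tendsto one_minus_rexp_quotient_tendsto) auto
  moreover have "\<forall>\<^sub>F \<epsilon> in at 0.
      ?h k1 \<epsilon> * ?h k2 \<epsilon> * (1 + rexp m1 \<epsilon>) * (1 + rexp m2 \<epsilon>) / (?h l \<epsilon> * (1 + rexp p \<epsilon>))
      = (1 - rexp k1 \<epsilon>) * (1 - rexp k2 \<epsilon>) * (1 + rexp m1 \<epsilon>) * (1 + rexp m2 \<epsilon>)
             / ((1 - rexp l \<epsilon>) * (1 + rexp p \<epsilon>)) / (1 - rexp 1 \<epsilon>)"
    using eventually_one_minus_rexp_nonzero by eventually_elim (simp add: divide_simps)
  ultimately have "((\<lambda>\<epsilon>. (1 - rexp k1 \<epsilon>) * (1 - rexp k2 \<epsilon>) * (1 + rexp m1 \<epsilon>) * (1 + rexp m2 \<epsilon>)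
             / ((1 - rexp l \<epsilon>) * (1 + rexp p \<epsilon>)) / (1 - rexp 1 \<epsilon>))
      \<longlongrightarrow> complex_of_real k1 * complex_of_real k2 * (1 + 1) * (1 + 1)
          / (complex_of_real l * (1 + 1))) (at 0)"
    by (rule Lim_transform_eventually)
  then show ?thesis
    by (simp add: field_simps)
qed

section \<open>Limits of the recurrence coefficients\<close>

lemma q_powi: "(- rexp 1 \<epsilon>) powi m = (if even m then rexp (of_int m) \<epsilon> else - rexp (of_int m) \<epsilon>)"
  by (simp add: power_int_minus_left rexp_powi)

lemma q_power: "(- rexp 1 \<epsilon>) ^ n = (if even n then rexp (real n) \<epsilon> else - rexp (real n) \<epsilon>)"
  by (simp add: rexp_power)

text \<open>
  The single factor \<open>-\<i>\<close> among the parameters makes a product of two of them positive when it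
  involves \<open>b\<close> and negative otherwise. With \<open>q\<^sup>n\<close> of sign \<open>(-1)\<^sup>n\<close>, these signs determine which
  factors of the coefficients vanish in the limit.
\<close>

lemma parameter_products:
  "\<i> * rexp \<alpha> \<epsilon> * (- \<i> * rexp \<beta> \<epsilon>) = rexp (\<alpha> + \<beta>) \<epsilon>"
  "\<i> * rexp \<alpha> \<epsilon> * (\<i> * rexp \<gamma> \<epsilon>) = - rexp (\<alpha> + \<gamma>) \<epsilon>"
  "- \<i> * rexp \<beta> \<epsilon> * (\<i> * rexp \<gamma> \<epsilon>) = rexp (\<beta> + \<gamma>) \<epsilon>"
  "rexp (\<alpha> + \<beta>) \<epsilon> * (\<i> * rexp \<gamma> \<epsilon>) * (\<i> * rexp \<delta> \<epsilon>) = - rexp (\<alpha> + \<beta> + \<gamma> + \<delta>) \<epsilon>"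
  by (simp_all add: rexp_def distrib_left exp_add complex_eq_iff)

text \<open>
  For even \<open>n\<close> the numerator factors with \<open>ab\<close> and \<open>abcd\<close> vanish in the limit, for odd \<open>n\<close> those
  with \<open>ac\<close> and \<open>ad\<close>. The extra divisor \<open>4\<i> a\<close> tends to \<open>-4\<close>, whence the sign.
\<close>

lemma AW_A_tendsto:
  fixes \<alpha> \<beta> \<gamma> \<delta> :: real and n :: nat
  defines "(S :: real) \<equiv> \<alpha> + \<beta> + \<gamma> + \<delta>"
  assumes nz: "S + 2 * real n - 1 \<noteq> 0"
  shows "((\<lambda>\<epsilon>. AW_A (\<i> * rexp \<alpha> \<epsilon>) (- \<i> * rexp \<beta> \<epsilon>) (\<i> * rexp \<gamma> \<epsilon>) (\<i> * rexp \<delta> \<epsilon>) (- rexp 1 \<epsilon>) n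
             / (4 * \<i> * (1 - rexp 1 \<epsilon>)))
          \<longlongrightarrow> complex_of_real
                (- (if even n then (\<alpha> + \<beta> + n) * (S + n - 1) else (\<alpha> + \<gamma> + n) * (\<alpha> + \<delta> + n))
                 / (2 * (S + 2 * real n - 1)))) (at 0)"
proof -
  \<comment> \<open>\<open>k1, k2\<close>: exponents of the vanishing numerator factors; \<open>m1, m2\<close>: of the other two.\<close>
  define k1 k2 m1 m2 where
    "k1 = (if even n then \<alpha> + \<beta> + n else \<alpha> + \<gamma> + n)" and
    "k2 = (if even n then S + n - 1 else \<alpha> + \<delta> + n)" and
    "m1 = (if even n then \<alpha> + \<gamma> + n else \<alpha> + \<beta> + n)" and
    "m2 = (if even n then \<alpha> + \<delta> + n else S + n - 1)"
  let ?F = "\<lambda>\<epsilon>. (1 - rexp k1 \<epsilon>) * (1 - rexp k2 \<epsilon>) * (1 + rexp m1 \<epsilon>) * (1 + rexp m2 \<epsilon>)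
             / ((1 - rexp (S + 2 * real n - 1) \<epsilon>) * (1 + rexp (S + 2 * real n) \<epsilon>)) / (1 - rexp 1 \<epsilon>)"
  have "((\<lambda>\<epsilon>. ?F \<epsilon> / (\<i> * rexp \<alpha> \<epsilon> * (4 * \<i>)))
      \<longlongrightarrow> complex_of_real (2 * k1 * k2 / (S + 2 * real n - 1)) / (\<i> * 1 * (4 * \<i>))) (at 0)"
    by (intro tendsto_intros rexp_tendsto rexp_quotient_tendsto nz) simp
  moreover have "?F \<epsilon> / (\<i> * rexp \<alpha> \<epsilon> * (4 * \<i>))
      = AW_A (\<i> * rexp \<alpha> \<epsilon>) (- \<i> * rexp \<beta> \<epsilon>) (\<i> * rexp \<gamma> \<epsilon>) (\<i> * rexp \<delta> \<epsilon>) (- rexp 1 \<epsilon>) n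
             / (4 * \<i> * (1 - rexp 1 \<epsilon>))" for \<epsilon>
    unfolding AW_A_def parameter_products q_powi q_power
    by (simp add: rexp_mult k1_def k2_def m1_def m2_def S_def add_diff_eq diff_add_eq ac_simps
        del: right_diff_distrib_numeral)
  moreover have "complex_of_real (2 * k1 * k2 / D) / (\<i> * 1 * (4 * \<i>)) = complex_of_real (- (k1 * k2) / (2 * D))" for D
    by simp
  moreover have "k1 * k2
      = (if even n then (\<alpha> + \<beta> + n) * (S + n - 1) else (\<alpha> + \<gamma> + n) * (\<alpha> + \<delta> + n))"
    by (simp add: k1_def k2_def)
  ultimately show ?thesis
    by (simp only:)
qed

text \<open>
  Here the vanishing numerator factors are \<open>1 - q\<^sup>n\<close> and the one with \<open>cd\<close> for even \<open>n\<close>, and those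
  with \<open>bc\<close> and \<open>bd\<close> for odd \<open>n\<close>. The limit formula also covers \<open>C\<^sub>0 = 0\<close>, through its factor \<open>n\<close>.
\<close>

lemma AW_C_tendsto:
  fixes \<alpha> \<beta> \<gamma> \<delta> :: real and n :: nat
  defines "(S :: real) \<equiv> \<alpha> + \<beta> + \<gamma> + \<delta>"
  assumes nz: "S + 2 * real n - 1 \<noteq> 0"
  shows "((\<lambda>\<epsilon>. AW_C (\<i> * rexp \<alpha> \<epsilon>) (- \<i> * rexp \<beta> \<epsilon>) (\<i> * rexp \<gamma> \<epsilon>) (\<i> * rexp \<delta> \<epsilon>) (- rexp 1 \<epsilon>) n
             / (4 * \<i> * (1 - rexp 1 \<epsilon>)))
          \<longlongrightarrow> complex_of_real
                ((if even n then real n * (\<gamma> + \<delta> + n - 1) else (\<beta> + \<gamma> + n - 1) * (\<beta> + \<delta> + n - 1))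
                 / (2 * (S + 2 * real n - 1)))) (at 0)"
proof (cases "n = 0")
  case True
  then show ?thesis
    by (simp add: AW_C_def)
next
  case False
  define k1 k2 m1 m2 where
    "k1 = (if even n then real n else \<beta> + \<gamma> + n - 1)" and
    "k2 = (if even n then \<gamma> + \<delta> + n - 1 else \<beta> + \<delta> + n - 1)" and
    "m1 = (if even n then \<beta> + \<gamma> + n - 1 else real n)" and
    "m2 = (if even n then \<beta> + \<delta> + n - 1 else \<gamma> + \<delta> + n - 1)"
  let ?F = "\<lambda>\<epsilon>. (1 - rexp k1 \<epsilon>) * (1 - rexp k2 \<epsilon>) * (1 + rexp m1 \<epsilon>) * (1 + rexp m2 \<epsilon>)
             / ((1 - rexp (S + 2 * real n - 1) \<epsilon>) * (1 + rexp (S + 2 * real n - 2) \<epsilon>)) / (1 - rexp 1 \<epsilon>)"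
  have "((\<lambda>\<epsilon>. ?F \<epsilon> * (\<i> * rexp \<alpha> \<epsilon> / (4 * \<i>)))
      \<longlongrightarrow> complex_of_real (2 * k1 * k2 / (S + 2 * real n - 1)) * (\<i> * 1 / (4 * \<i>))) (at 0)"
    by (intro tendsto_intros rexp_tendsto rexp_quotient_tendsto nz) simp
  moreover have "?F \<epsilon> * (\<i> * rexp \<alpha> \<epsilon> / (4 * \<i>))
      = AW_C (\<i> * rexp \<alpha> \<epsilon>) (- \<i> * rexp \<beta> \<epsilon>) (\<i> * rexp \<gamma> \<epsilon>) (\<i> * rexp \<delta> \<epsilon>) (- rexp 1 \<epsilon>) n
             / (4 * \<i> * (1 - rexp 1 \<epsilon>))" for \<epsilon>
  proof -
    \<comment> \<open>Truncated subtraction is harmless in the exponents because \<open>n > 0\<close>.\<close>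
    have "real (n - 1) = real n - 1" "real (2 * n - 1) = 2 * real n - 1"
      "real (2 * n - 2) = 2 * real n - 2"
      "even (n - 1) \<longleftrightarrow> odd n" "odd (2 * n - 1)" "even (2 * n - 2)"
      using False by (auto simp: of_nat_diff)
    then show ?thesis
      unfolding AW_C_def parameter_products q_power
      using False
      by (simp add: rexp_mult k1_def k2_def m1_def m2_def S_def add_diff_eq diff_add_eq ac_simps
        del: right_diff_distrib_numeral)
  qed
  moreover have "complex_of_real (2 * k1 * k2 / D) * (\<i> * 1 / (4 * \<i>)) = complex_of_real (k1 * k2 / (2 * D))" for D
    by simp
  moreover have "k1 * k2
      = (if even n then real n * (\<gamma> + \<delta> + n - 1) else (\<beta> + \<gamma> + n - 1) * (\<beta> + \<delta> + n - 1))"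
    by (simp add: k1_def k2_def)
  ultimately show ?thesis
    by (simp only:)
qed

section \<open>Passage to the limit in the recurrence\<close>

text \<open>
  The factor \<open>\<i>\<close> turns the sum \<open>z + 1/z\<close> into a multiple of the difference \<open>e\<^bsup>k\<epsilon>\<^esup> - e\<^bsup>-k\<epsilon>\<^esup>\<close>, which
  is what makes it vanish. This serves both \<open>z\<close> (where \<open>k = -2y\<close>) and the parameter \<open>a\<close>.
\<close>

lemma imaginary_sum_tendsto:
  "((\<lambda>\<epsilon>. (\<i> * rexp k \<epsilon> + inverse (\<i> * rexp k \<epsilon>)) / (4 * \<i> * (1 - rexp 1 \<epsilon>)))
     \<longlongrightarrow> complex_of_real (- k / 2)) (at 0)"
proof -
  let ?h = "\<lambda>k \<epsilon>. (1 - rexp k \<epsilon>) / (1 - rexp 1 \<epsilon>)"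
  have "((\<lambda>\<epsilon>. (?h (- k) \<epsilon> - ?h k \<epsilon>) / 4)
      \<longlongrightarrow> (complex_of_real (- k) - complex_of_real k) / 4) (at 0)"
    by (intro tendsto_intros one_minus_rexp_quotient_tendsto) simp
  moreover have "(?h (- k) \<epsilon> - ?h k \<epsilon>) / 4
      = (\<i> * rexp k \<epsilon> + inverse (\<i> * rexp k \<epsilon>)) / (4 * \<i> * (1 - rexp 1 \<epsilon>))" for \<epsilon>
  proof -
    have "\<i> * rexp k \<epsilon> + inverse (\<i> * rexp k \<epsilon>) = \<i> * (rexp k \<epsilon> - rexp (- k) \<epsilon>)"
      by (simp add: inverse_rexp algebra_simps)
    then show ?thesis
      by (simp add: diff_divide_distrib[symmetric] mult.commute)
  qed
  ultimately show ?thesis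
    by simp
qed

theorem mainTheorem14:
  fixes r1 r2 \<rho>1 \<rho>2 y :: real and n :: nat
  assumes "\<And>k :: nat. k \<ge> 1 \<Longrightarrow> \<rho>1 + \<rho>2 - r1 - r2 \<noteq> - real k"
  shows "((\<lambda>\<epsilon> :: real.
            let q = - complex_of_real (exp \<epsilon>);
                a = \<i> * complex_of_real (exp (\<epsilon> * (2*\<rho>1 + 3/2)));
                b = - \<i> * complex_of_real (exp (\<epsilon> * (2*\<rho>2 + 1/2)));
                c = \<i> * complex_of_real (exp (\<epsilon> * (- 2*r2 + 1/2)));
                d = \<i> * complex_of_real (exp (\<epsilon> * (- 2*r1 + 1/2)));
                z = \<i> * complex_of_real (exp (- 2 * \<epsilon> * y))
            in poly (askey_wilson_Q a b c d q n) (z + inverse z) / (4 * \<i> * (1 + q)) ^ n)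
          \<longlongrightarrow> complex_of_real (poly (comp_bannai_ito_W r1 r2 \<rho>1 \<rho>2 n) (y - 1/4))) (at 0)"
proof -
  define \<alpha> \<beta> \<gamma> \<delta> where
    "\<alpha> = 2*\<rho>1 + 3/2" and "\<beta> = 2*\<rho>2 + 1/2" and "\<gamma> = - 2*r2 + 1/2" and "\<delta> = - 2*r1 + 1/2"
  define g where "g = \<rho>1 + \<rho>2 - r1 - r2"
  have S: "\<alpha> + \<beta> + \<gamma> + \<delta> = 2 * g + 3"
    by (simp add: \<alpha>_def \<beta>_def \<gamma>_def \<delta>_def g_def)
  have g_nz: "g + n + 1 \<noteq> 0" for n :: nat
    using assms[of "Suc n"] by (auto simp: g_def)
  have nz: "\<alpha> + \<beta> + \<gamma> + \<delta> + 2 * real n - 1 \<noteq> 0" for n :: nat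
    using g_nz[of n] unfolding S by simp
  define h where "h \<epsilon> = 4 * \<i> * (1 - rexp 1 \<epsilon>)" for \<epsilon>
  define A where "A n \<epsilon> = AW_A (\<i> * rexp \<alpha> \<epsilon>) (- \<i> * rexp \<beta> \<epsilon>) (\<i> * rexp \<gamma> \<epsilon>) (\<i> * rexp \<delta> \<epsilon>) (- rexp 1 \<epsilon>) n" for n \<epsilon>
  define C where "C n \<epsilon> = AW_C (\<i> * rexp \<alpha> \<epsilon>) (- \<i> * rexp \<beta> \<epsilon>) (\<i> * rexp \<gamma> \<epsilon>) (\<i> * rexp \<delta> \<epsilon>) (- rexp 1 \<epsilon>) n" for n \<epsilon>
  define Q where "Q n \<epsilon> = askey_wilson_Q (\<i> * rexp \<alpha> \<epsilon>) (- \<i> * rexp \<beta> \<epsilon>) (\<i> * rexp \<gamma> \<epsilon>) (\<i> * rexp \<delta> \<epsilon>) (- rexp 1 \<epsilon>) n" for n \<epsilon>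
  define X where "X k \<epsilon> = \<i> * rexp k \<epsilon> + inverse (\<i> * rexp k \<epsilon>)" for k \<epsilon>
  define A' where "A' n = - (if even n then (\<alpha> + \<beta> + n) * (2 * g + 3 + n - 1)
      else (\<alpha> + \<gamma> + n) * (\<alpha> + \<delta> + n)) / (2 * (2 * g + 3 + 2 * real n - 1))" for n :: nat
  define C' where "C' n = (if even n then real n * (\<gamma> + \<delta> + n - 1)
      else (\<beta> + \<gamma> + n - 1) * (\<beta> + \<delta> + n - 1)) / (2 * (2 * g + 3 + 2 * real n - 1))" for n :: nat
  have limA: "((\<lambda>\<epsilon>. A n \<epsilon> / h \<epsilon>) \<longlongrightarrow> complex_of_real (A' n)) (at 0)" for n
    using AW_A_tendsto[OF nz] unfolding A_def A'_def h_def S .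
  have limC: "((\<lambda>\<epsilon>. C n \<epsilon> / h \<epsilon>) \<longlongrightarrow> complex_of_real (C' n)) (at 0)" for n
    using AW_C_tendsto[OF nz] unfolding C_def C'_def h_def S .
  have limX: "((\<lambda>\<epsilon>. X k \<epsilon> / h \<epsilon>) \<longlongrightarrow> complex_of_real (- k / 2)) (at 0)" for k
    using imaginary_sum_tendsto unfolding X_def h_def .
  have cancel4: "- (4 * u) / (4 * v) = - (u / v)" "(4 * u) / (4 * v) = u / v" for u v :: real
    by simp_all
  have A'_even: "A' (2 * m)
      = - ((real m + \<rho>1 + \<rho>2 + 1) * (real m + g + 1) / (2 * real m + 1 + g))" (is "_ = - (?P / ?D)")
    and C'_even: "C' (2 * m) = real m * (real m - r1 - r2) / (2 * real m + 1 + g)" (is "_ = ?R / _")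
    for m
  proof -
    have parity: "even (2 * m)"
      by simp
    have D: "2 * (2 * g + 3 + 2 * real (2 * m) - 1) = 4 * ?D"
      by simp
    have "(\<alpha> + \<beta> + real (2 * m)) * (2 * g + 3 + real (2 * m) - 1) = 4 * ?P"
      by (simp add: \<alpha>_def \<beta>_def algebra_simps)
    then show "A' (2 * m) = - (?P / ?D)"
      by (simp only: A'_def D parity if_True if_False simp_thms cancel4)
    have "real (2 * m) * (\<gamma> + \<delta> + real (2 * m) - 1) = 4 * ?R"
      by (simp add: \<gamma>_def \<delta>_def algebra_simps)
    then show "C' (2 * m) = ?R / ?D"
      by (simp only: C'_def D parity if_True if_False simp_thms cancel4)
  qed
  have A'_odd: "A' (2 * m + 1)
      = - ((real (Suc m) + \<rho>1 - r1 + 1/2) * (real (Suc m) + \<rho>1 - r2 + 1/2) / (2 * real m + 2 + g))"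
      (is "_ = - (?P / ?D)")
    and C'_odd: "C' (2 * m + 1)
      = (real m + \<rho>2 - r1 + 1/2) * (real m + \<rho>2 - r2 + 1/2) / (2 * real m + 2 + g)" (is "_ = ?R / _")
    for m
  proof -
    have parity: "odd (2 * m + 1)"
      by simp
    have D: "2 * (2 * g + 3 + 2 * real (2 * m + 1) - 1) = 4 * ?D"
      by simp
    have "(\<alpha> + \<gamma> + real (2 * m + 1)) * (\<alpha> + \<delta> + real (2 * m + 1)) = 4 * ?P"
      by (simp add: \<alpha>_def \<gamma>_def \<delta>_def algebra_simps)
    then show "A' (2 * m + 1) = - (?P / ?D)"
      by (simp only: A'_def D parity if_True if_False simp_thms cancel4)
    have "(\<beta> + \<gamma> + real (2 * m + 1) - 1) * (\<beta> + \<delta> + real (2 * m + 1) - 1) = 4 * ?R"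
      by (simp add: \<beta>_def \<gamma>_def \<delta>_def algebra_simps)
    then show "C' (2 * m + 1) = ?R / ?D"
      by (simp only: C'_def D parity if_True if_False simp_thms cancel4)
  qed
  \<comment> \<open>The factor \<open>g + n + 1\<close> of the denominator divides the numerator of \<open>A' n + C' n\<close>.\<close>
  have diag: "- (- 2 * y) / 2 - (- \<alpha> / 2 - A' n - C' n) = y - 1/4 - (-1)^n * \<rho>2" for n
  proof (cases "even n")
    case True
    then obtain m where m: "n = 2 * m" by (elim evenE)
    have "2 * real m + 1 + g \<noteq> 0"
      using g_nz[of "2 * m"] by (simp add: add_ac)
    moreover have "- ((real m + \<rho>1 + \<rho>2 + 1) * (real m + g + 1))
        + real m * (real m - r1 - r2) = - (\<rho>1 + \<rho>2 + 1) * (2 * real m + 1 + g)"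
      by (simp add: g_def field_simps)
    then have "A' n + C' n = - (\<rho>1 + \<rho>2 + 1) * (2 * real m + 1 + g) / (2 * real m + 1 + g)"
      unfolding m A'_even C'_even minus_divide_left add_divide_distrib[symmetric] by simp
    ultimately have "A' n + C' n = - (\<rho>1 + \<rho>2 + 1)"
      by simp
    then show ?thesis
      using True by (simp add: \<alpha>_def field_simps)
  next
    case False
    then obtain m where m: "n = 2 * m + 1" by (elim oddE)
    have "2 * real m + 2 + g \<noteq> 0"
      using g_nz[of "2 * m + 1"] by (simp add: add_ac)
    moreover have "- ((real (Suc m) + \<rho>1 - r1 + 1/2) * (real (Suc m) + \<rho>1 - r2 + 1/2))
        + (real m + \<rho>2 - r1 + 1/2) * (real m + \<rho>2 - r2 + 1/2)
        = (\<rho>2 - \<rho>1 - 1) * (2 * real m + 2 + g)"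
      by (simp add: g_def field_simps)
    then have "A' n + C' n = (\<rho>2 - \<rho>1 - 1) * (2 * real m + 2 + g) / (2 * real m + 2 + g)"
      unfolding m A'_odd C'_odd minus_divide_left add_divide_distrib[symmetric] by simp
    ultimately have "A' n + C' n = \<rho>2 - \<rho>1 - 1"
      by simp
    then show ?thesis
      using False by (simp add: \<alpha>_def field_simps)
  qed
  have offdiag: "A' n * C' (Suc n) = CBI_v r1 r2 \<rho>1 \<rho>2 (Suc n)" for n
  proof (cases "even n")
    case True
    then obtain m where m: "n = 2 * m" by (elim evenE)
    have "A' n * C' (Suc n) = A' (2 * m) * C' (2 * m + 1)"
      by (simp add: m)
    then show ?thesis
      unfolding A'_even C'_odd by (simp add: CBI_v_def m Let_def add_ac g_def)
  next
    case False
    then obtain m where m: "n = 2 * m + 1" by (elim oddE)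
    have "A' n * C' (Suc n) = A' (2 * m + 1) * C' (2 * Suc m)"
      by (simp add: m)
    then show ?thesis
      unfolding A'_odd C'_even by (simp add: CBI_v_def m Let_def mult_ac g_def)
  qed
  have lim_diag: "((\<lambda>\<epsilon>. (X (- 2 * y) \<epsilon> - (X \<alpha> \<epsilon> - A n \<epsilon> - C n \<epsilon>)) / h \<epsilon>)
      \<longlongrightarrow> complex_of_real (y - 1/4 - (-1)^n * \<rho>2)) (at 0)" for n
    unfolding diag[symmetric] of_real_diff diff_divide_distrib by (intro tendsto_intros limA limC limX)
  have lim_offdiag: "((\<lambda>\<epsilon>. (A n \<epsilon> / h \<epsilon>) * (C (Suc n) \<epsilon> / h \<epsilon>))
      \<longlongrightarrow> complex_of_real (CBI_v r1 r2 \<rho>1 \<rho>2 (Suc n))) (at 0)" for n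
    unfolding offdiag[symmetric] of_real_mult by (intro tendsto_intros limA limC)
  have main: "((\<lambda>\<epsilon>. poly (Q n \<epsilon>) (X (- 2 * y) \<epsilon>) / h \<epsilon> ^ n)
      \<longlongrightarrow> complex_of_real (poly (comp_bannai_ito_W r1 r2 \<rho>1 \<rho>2 n) (y - 1/4))) (at 0)" for n
  proof (induction n rule: induct_nat_012)
    case 0
    then show ?case by (simp add: Q_def)
  next
    case 1
    have "poly (Q (Suc 0) \<epsilon>) (X (- 2 * y) \<epsilon>) = X (- 2 * y) \<epsilon> - (X \<alpha> \<epsilon> - A 0 \<epsilon> - C 0 \<epsilon>)" for \<epsilon>
      by (simp add: Q_def X_def A_def C_def)
    then show ?case
      using lim_diag[of 0] by simp
  next
    case (ge2 n)
    let ?P = "\<lambda>n \<epsilon>. poly (Q n \<epsilon>) (X (- 2 * y) \<epsilon>) / h \<epsilon> ^ n"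
    have "((\<lambda>\<epsilon>. (X (- 2 * y) \<epsilon> - (X \<alpha> \<epsilon> - A (Suc n) \<epsilon> - C (Suc n) \<epsilon>)) / h \<epsilon> * ?P (Suc n) \<epsilon>
           - (A n \<epsilon> / h \<epsilon>) * (C (Suc n) \<epsilon> / h \<epsilon>) * ?P n \<epsilon>)
      \<longlongrightarrow> complex_of_real (y - 1/4 - (-1)^Suc n * \<rho>2)
            * complex_of_real (poly (comp_bannai_ito_W r1 r2 \<rho>1 \<rho>2 (Suc n)) (y - 1/4))
          - complex_of_real (CBI_v r1 r2 \<rho>1 \<rho>2 (Suc n))
            * complex_of_real (poly (comp_bannai_ito_W r1 r2 \<rho>1 \<rho>2 n) (y - 1/4))) (at 0)"
      by (intro tendsto_intros lim_diag lim_offdiag ge2)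
    moreover have "(X (- 2 * y) \<epsilon> - (X \<alpha> \<epsilon> - A (Suc n) \<epsilon> - C (Suc n) \<epsilon>)) / h \<epsilon> * ?P (Suc n) \<epsilon>
           - (A n \<epsilon> / h \<epsilon>) * (C (Suc n) \<epsilon> / h \<epsilon>) * ?P n \<epsilon> = ?P (Suc (Suc n)) \<epsilon>" for \<epsilon>
    proof -
      have "poly (Q (Suc (Suc n)) \<epsilon>) x
          = (x - (X \<alpha> \<epsilon> - A (Suc n) \<epsilon> - C (Suc n) \<epsilon>)) * poly (Q (Suc n) \<epsilon>) x
            - A n \<epsilon> * C (Suc n) \<epsilon> * poly (Q n \<epsilon>) x" for x
        by (simp add: Q_def X_def A_def C_def algebra_simps)
      then show ?thesis
        by (simp add: diff_divide_distrib[symmetric] power2_eq_square mult_ac)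
    qed
    moreover have "complex_of_real (y - 1/4 - (-1)^Suc n * \<rho>2)
            * complex_of_real (poly (comp_bannai_ito_W r1 r2 \<rho>1 \<rho>2 (Suc n)) (y - 1/4))
          - complex_of_real (CBI_v r1 r2 \<rho>1 \<rho>2 (Suc n))
            * complex_of_real (poly (comp_bannai_ito_W r1 r2 \<rho>1 \<rho>2 n) (y - 1/4))
        = complex_of_real (poly (comp_bannai_ito_W r1 r2 \<rho>1 \<rho>2 (Suc (Suc n))) (y - 1/4))"
      by (simp add: algebra_simps)
    ultimately show ?case
      by simp
  qed
  show ?thesis
    using main[of n]
    by (simp add: Q_def X_def h_def rexp_def \<alpha>_def \<beta>_def \<gamma>_def \<delta>_def Let_def mult_ac)
qed

end
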